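(* Let $$C_{min}=\inf\left\{C\in\mathbb{R}:\ Q(W')\le C\,|W'|^3\ \text{ for every algebraic Weyl curvature tensor } W' \text{ on } \mathbb{R}^6\right\}.$$ Then $$C_{min}\ge\sqrt{\frac{3}{10}}.$$
   Context: $\mathbb{R}^6$ carries its standard inner product; components are taken in an orthonormal basis and repeated indices are summed from $1$ to $6$. An algebraic Weyl curvature tensor on $\mathbb{R}^6$ is a $(0,4)$-tensor $W'$ having the symmetries of a Riemann curvature tensor, namely $W'_{ijkl}=-W'_{jikl}=-W'_{ijlk}$, $W'_{ijkl}=W'_{klij}$, $W'_{ijkl}+W'_{iklj}+W'_{iljk}=0$, and which is totally trace-free, $W'_{ikjk}=0$ for all $i,j$. Its norm is the full tensor norm, $|W'|^2=W'_{ijkl}W'_{ijkl}$, and $$Q(W')=2W'_{pqrs}W'_{ptru}W'_{qtsu}+\tfrac12W'_{pqrs}W'_{pqtu}W'_{rstu}.$$ *)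

theory Defs
  imports "HOL-Analysis.Analysis"
begin

type_synonym tensor4 = "real^6 \<Rightarrow> real^6 \<Rightarrow> real^6 \<Rightarrow> real^6 \<Rightarrow> real"

definition multilinear4 :: "tensor4 \<Rightarrow> bool" where
  "multilinear4 W \<longleftrightarrow>
     (\<forall>y z w. linear (\<lambda>x. W x y z w)) \<and>
     (\<forall>x z w. linear (\<lambda>y. W x y z w)) \<and>
     (\<forall>x y w. linear (\<lambda>z. W x y z w)) \<and>
     (\<forall>x y z. linear (\<lambda>w. W x y z w))"

text \<open>Components are taken in the standard orthonormal basis. The index type \<open>6\<close> has
  exactly six elements, and sums over an index range over all of them.\<close>

definition comp4 :: "tensor4 \<Rightarrow> 6 \<Rightarrow> 6 \<Rightarrow> 6 \<Rightarrow> 6 \<Rightarrow> real" where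
  "comp4 W i j k l = W (axis i 1) (axis j 1) (axis k 1) (axis l 1)"

definition has_curvature_symmetries :: "tensor4 \<Rightarrow> bool" where
  "has_curvature_symmetries W \<longleftrightarrow>
     (\<forall>i j k l. comp4 W i j k l = - comp4 W j i k l) \<and>
     (\<forall>i j k l. comp4 W i j k l = - comp4 W i j l k) \<and>
     (\<forall>i j k l. comp4 W i j k l = comp4 W k l i j) \<and>
     (\<forall>i j k l. comp4 W i j k l + comp4 W i k l j + comp4 W i l j k = 0)"

definition trace_free :: "tensor4 \<Rightarrow> bool" where
  "trace_free W \<longleftrightarrow> (\<forall>i j. (\<Sum>k\<in>UNIV. comp4 W i k j k) = 0)"

definition weyl_tensor :: "tensor4 \<Rightarrow> bool" where
  "weyl_tensor W \<longleftrightarrow> multilinear4 W \<and> has_curvature_symmetries W \<and> trace_free W"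

definition tensor_norm :: "tensor4 \<Rightarrow> real" where
  "tensor_norm W =
     sqrt (\<Sum>i\<in>UNIV. \<Sum>j\<in>UNIV. \<Sum>k\<in>UNIV. \<Sum>l\<in>UNIV. comp4 W i j k l * comp4 W i j k l)"

definition Q :: "tensor4 \<Rightarrow> real" where
  "Q W =
     2 * (\<Sum>p\<in>UNIV. \<Sum>q\<in>UNIV. \<Sum>r\<in>UNIV. \<Sum>s\<in>UNIV. \<Sum>t\<in>UNIV. \<Sum>u\<in>UNIV.
            comp4 W p q r s * comp4 W p t r u * comp4 W q t s u)
     + 1 / 2 * (\<Sum>p\<in>UNIV. \<Sum>q\<in>UNIV. \<Sum>r\<in>UNIV. \<Sum>s\<in>UNIV. \<Sum>t\<in>UNIV. \<Sum>u\<in>UNIV.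
            comp4 W p q r s * comp4 W p q t u * comp4 W r s t u)"

definition C_min :: real where
  "C_min = Inf {C :: real. \<forall>W. weyl_tensor W \<longrightarrow> Q W \<le> C * tensor_norm W ^ 3}"

end

theory Submission
  imports Defs
begin

(* The bound is attained, with room to spare, on a four-dimensional subspace. The three self-dual
   2-forms of R^4 (the Kaehler forms of the quaternionic structure) satisfy
   \<langle>\<omega>_a, \<omega>_b\<rangle> = 4 \<delta>_ab and trace(\<omega>_a \<omega>_b \<omega>_c) = \<plusminus>4 \<epsilon>_abc. For weights c with sum 0, W = \<Sum> c_a \<omega>_a \<otimes> \<omega>_a is a
   Weyl tensor, and the contractions in |W| and Q(W) factor through these pairings. The weights
   (2,-1,-1), the Weyl tensor of the complex projective plane, give |W|^2 = 96, Q(W) = 576, hence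
   Q(W) = sqrt(3/8) |W|^3. *)

definition wedge :: "'n \<Rightarrow> 'n \<Rightarrow> real^'n \<Rightarrow> real^'n \<Rightarrow> real" where
  "wedge i j x y = x $ i * y $ j - x $ j * y $ i"

text \<open>The forms live on coordinates 0 to 3 and vanish in directions 4 and 5. The signs give
  all three the same square: each \<omega>_a \<and> \<omega>_a is twice the volume form of
  R^4.\<close>

definition self_dual :: "3 \<Rightarrow> real^6 \<Rightarrow> real^6 \<Rightarrow> real" where
  "self_dual a x y =
     (if a = 1 then wedge 0 1 x y + wedge 2 3 x y
      else if a = 2 then wedge 0 2 x y - wedge 1 3 x y
      else wedge 0 3 x y + wedge 1 2 x y)"

definition weight :: "3 \<Rightarrow> real" where
  "weight a = (if a = 1 then 2 else - 1)"

definition extremal :: tensor4 where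
  "extremal x y z w = (\<Sum>a\<in>UNIV. weight a * self_dual a x y * self_dual a z w)"

lemma index_distinct [simp]:
  "(0::6) \<noteq> 1" "(0::6) \<noteq> 2" "(0::6) \<noteq> 3" "(1::6) \<noteq> 2" "(1::6) \<noteq> 3" "(2::6) \<noteq> 3"
  "(1::6) \<noteq> 0" "(2::6) \<noteq> 0" "(3::6) \<noteq> 0" "(2::6) \<noteq> 1" "(3::6) \<noteq> 1" "(3::6) \<noteq> 2"
  "(1::3) \<noteq> 2" "(1::3) \<noteq> 3" "(2::3) \<noteq> 3" "(2::3) \<noteq> 1" "(3::3) \<noteq> 1" "(3::3) \<noteq> 2"
  by simp_all

section \<open>Contractions with the self-dual forms\<close>

lemma sum_axis_mult:
  fixes f :: "'n::finite \<Rightarrow> real"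
  shows "(\<Sum>p\<in>UNIV. axis p 1 $ i * f p) = f i"
proof -
  have "(\<Sum>p\<in>UNIV. axis p 1 $ i * f p) = (\<Sum>p\<in>UNIV. if p = i then f p else 0)"
    by (rule sum.cong) (auto simp: axis_def)
  then show ?thesis by simp
qed

lemma sum_wedge_mult:
  fixes f :: "'n::finite \<Rightarrow> 'n \<Rightarrow> real"
  shows "(\<Sum>p\<in>UNIV. \<Sum>q\<in>UNIV. wedge i j (axis p 1) (axis q 1) * f p q) = f i j - f j i"
  by (simp add: wedge_def left_diff_distrib sum_subtractf mult.assoc sum_axis_mult
      flip: sum_distrib_left)

text \<open>Each \<open>wedge\<close> picks out two entries of \<open>f\<close>, so 36 summands
  collapse to four. An arbitrary \<open>f\<close> lets one rule serve both the Gram matrix and the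
  triple contraction.\<close>

lemma sum_self_dual_mult:
  "(\<Sum>p\<in>UNIV. \<Sum>q\<in>UNIV. self_dual a (axis p 1) (axis q 1) * f p q) =
     (if a = 1 then f 0 1 - f 1 0 + (f 2 3 - f 3 2)
      else if a = 2 then f 0 2 - f 2 0 - (f 1 3 - f 3 1)
      else f 0 3 - f 3 0 + (f 1 2 - f 2 1))"
  by (simp add: self_dual_def distrib_right left_diff_distrib sum.distrib sum_subtractf
      sum_wedge_mult)

lemma sum_self_dual_right_mult:
  "(\<Sum>t\<in>UNIV. self_dual a x (axis t 1) * f t) =
     (if a = 1 then x $ 0 * f 1 - x $ 1 * f 0 + (x $ 2 * f 3 - x $ 3 * f 2)
      else if a = 2 then x $ 0 * f 2 - x $ 2 * f 0 - (x $ 1 * f 3 - x $ 3 * f 1)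
      else x $ 0 * f 3 - x $ 3 * f 0 + (x $ 1 * f 2 - x $ 2 * f 1))"
  by (simp add: self_dual_def wedge_def distrib_right left_diff_distrib sum.distrib
      sum_subtractf mult.assoc sum_axis_mult flip: sum_distrib_left)

text \<open>Each form has exactly four nonzero entries, all 1 or -1, and different forms have
  disjoint supports.\<close>

lemma self_dual_gram:
  "(\<Sum>p\<in>UNIV. \<Sum>q\<in>UNIV. self_dual a (axis p 1) (axis q 1) * self_dual b (axis p 1) (axis q 1)) =
     (if a = b then 4 else 0)"
  unfolding sum_self_dual_mult unfolding self_dual_def wedge_def
  using exhaust_3[of a] exhaust_3[of b]
  by (elim disjE) (simp_all add: axis_def)

text \<open>As matrices on R^4 the forms are quaternion units: the product of two different ones is
  the third up to sign, which gives 4 or -4. If two indices agree, what remains is the trace of a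
  multiple of one form, hence 0. Squaring removes the sign.\<close>

lemma self_dual_triple:
  "(\<Sum>p\<in>UNIV. \<Sum>q\<in>UNIV. \<Sum>t\<in>UNIV. self_dual a (axis p 1) (axis q 1) *
      self_dual b (axis p 1) (axis t 1) * self_dual c (axis q 1) (axis t 1))\<^sup>2 =
     (if a \<noteq> b \<and> b \<noteq> c \<and> a \<noteq> c then 16 else 0)"
proof -
  have inner: "(\<Sum>t\<in>UNIV. self_dual a x y * self_dual b x (axis t 1) * self_dual c y (axis t 1)) =
      self_dual a x y * (\<Sum>t\<in>UNIV. self_dual b x (axis t 1) * self_dual c y (axis t 1))" for x y
    by (simp add: sum_distrib_left mult.assoc)
  show ?thesis
    unfolding inner sum_self_dual_mult
    using exhaust_3[of a] exhaust_3[of b] exhaust_3[of c]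
    \<comment> \<open>The sum over \<open>t\<close> is contracted while \<open>self_dual\<close> is
      still folded, so that the rule matches; only then are the entries evaluated.\<close>
    by (elim disjE; simp only: sum_self_dual_right_mult index_distinct if_True if_False simp_thms;
        simp add: self_dual_def wedge_def axis_def)
qed

section \<open>Contractions of weighted sums of squares of forms\<close>

lemma sum_product3:
  fixes f :: "'a \<Rightarrow> real"
  shows "sum f A * sum g B * sum h C = (\<Sum>a\<in>A. \<Sum>b\<in>B. \<Sum>c\<in>C. f a * g b * h c)"
  by (subst sum_product, simp only: sum_distrib_right, simp only: sum_distrib_left)

text \<open>Two distinct index types make \<open>sum.swap\<close>, instantiated at them, a
  terminating rewrite: it only moves sums over \<open>'a\<close> outward past sums over
  \<open>'n\<close>.\<close>

lemma sum_swap_4_2: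
  fixes f :: "'n::finite \<Rightarrow> 'n \<Rightarrow> 'n \<Rightarrow> 'n \<Rightarrow> 'a::finite \<Rightarrow> 'a \<Rightarrow> real"
  shows "(\<Sum>p\<in>UNIV. \<Sum>q\<in>UNIV. \<Sum>r\<in>UNIV. \<Sum>s\<in>UNIV. \<Sum>a\<in>UNIV. \<Sum>b\<in>UNIV. f p q r s a b) =
    (\<Sum>a\<in>UNIV. \<Sum>b\<in>UNIV. \<Sum>p\<in>UNIV. \<Sum>q\<in>UNIV. \<Sum>r\<in>UNIV. \<Sum>s\<in>UNIV. f p q r s a b)"
  by (simp only: sum.swap[where A = "UNIV :: 'n set" and B = "UNIV :: 'a set"])

lemma sum_swap_6_3:
  fixes f :: "'n::finite \<Rightarrow> 'n \<Rightarrow> 'n \<Rightarrow> 'n \<Rightarrow> 'n \<Rightarrow> 'n \<Rightarrow> 'a::finite \<Rightarrow> 'a \<Rightarrow> 'a \<Rightarrow> real"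
  shows "(\<Sum>p\<in>UNIV. \<Sum>q\<in>UNIV. \<Sum>r\<in>UNIV. \<Sum>s\<in>UNIV. \<Sum>t\<in>UNIV. \<Sum>u\<in>UNIV.
      \<Sum>a\<in>UNIV. \<Sum>b\<in>UNIV. \<Sum>c\<in>UNIV. f p q r s t u a b c) =
    (\<Sum>a\<in>UNIV. \<Sum>b\<in>UNIV. \<Sum>c\<in>UNIV. \<Sum>p\<in>UNIV. \<Sum>q\<in>UNIV. \<Sum>r\<in>UNIV. \<Sum>s\<in>UNIV. \<Sum>t\<in>UNIV.
      \<Sum>u\<in>UNIV. f p q r s t u a b c)"
  by (simp only: sum.swap[where A = "UNIV :: 'n set" and B = "UNIV :: 'a set"])

context
  fixes c :: "'a::finite \<Rightarrow> real" and \<omega> :: "'a \<Rightarrow> 'n::finite \<Rightarrow> 'n \<Rightarrow> real"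
    and W :: "'n \<Rightarrow> 'n \<Rightarrow> 'n \<Rightarrow> 'n \<Rightarrow> real"
  assumes W: "\<And>p q r s. W p q r s = (\<Sum>a\<in>UNIV. c a * \<omega> a p q * \<omega> a r s)"
begin

lemma form_square_norm:
  "(\<Sum>p\<in>UNIV. \<Sum>q\<in>UNIV. \<Sum>r\<in>UNIV. \<Sum>s\<in>UNIV. W p q r s * W p q r s) =
   (\<Sum>a\<in>UNIV. \<Sum>b\<in>UNIV. c a * c b * (\<Sum>p\<in>UNIV. \<Sum>q\<in>UNIV. \<omega> a p q * \<omega> b p q)\<^sup>2)"
proof -
  have "(\<Sum>p\<in>UNIV. \<Sum>q\<in>UNIV. \<Sum>r\<in>UNIV. \<Sum>s\<in>UNIV. W p q r s * W p q r s) =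
    (\<Sum>p\<in>UNIV. \<Sum>q\<in>UNIV. \<Sum>r\<in>UNIV. \<Sum>s\<in>UNIV. \<Sum>a\<in>UNIV. \<Sum>b\<in>UNIV.
      (c a * c b) * (\<omega> a p q * \<omega> b p q) * (\<omega> a r s * \<omega> b r s))"
    by (simp add: W sum_product mult_ac)
  also have "\<dots> = (\<Sum>a\<in>UNIV. \<Sum>b\<in>UNIV. \<Sum>p\<in>UNIV. \<Sum>q\<in>UNIV. \<Sum>r\<in>UNIV. \<Sum>s\<in>UNIV.
      (c a * c b) * (\<omega> a p q * \<omega> b p q) * (\<omega> a r s * \<omega> b r s))"
    by (rule sum_swap_4_2)
  finally show ?thesis
    by (simp only: power2_eq_square flip: sum_distrib_left sum_distrib_right)
      (simp only: mult.assoc)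
qed

text \<open>The first index pairs involve only p, q, t and the second pairs only r, s, u, in the
  same pattern. The sum therefore splits into two equal factors.\<close>

lemma form_square_cubic1:
  "(\<Sum>p\<in>UNIV. \<Sum>q\<in>UNIV. \<Sum>r\<in>UNIV. \<Sum>s\<in>UNIV. \<Sum>t\<in>UNIV. \<Sum>u\<in>UNIV.
      W p q r s * W p t r u * W q t s u) =
   (\<Sum>a\<in>UNIV. \<Sum>b\<in>UNIV. \<Sum>d\<in>UNIV. c a * c b * c d *
      (\<Sum>p\<in>UNIV. \<Sum>q\<in>UNIV. \<Sum>t\<in>UNIV. \<omega> a p q * \<omega> b p t * \<omega> d q t)\<^sup>2)"
proof -
  have "(\<Sum>p\<in>UNIV. \<Sum>q\<in>UNIV. \<Sum>r\<in>UNIV. \<Sum>s\<in>UNIV. \<Sum>t\<in>UNIV. \<Sum>u\<in>UNIV.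
      W p q r s * W p t r u * W q t s u) =
    (\<Sum>p\<in>UNIV. \<Sum>q\<in>UNIV. \<Sum>r\<in>UNIV. \<Sum>s\<in>UNIV. \<Sum>t\<in>UNIV. \<Sum>u\<in>UNIV.
      \<Sum>a\<in>UNIV. \<Sum>b\<in>UNIV. \<Sum>d\<in>UNIV.
      (c a * c b * c d) * (\<omega> a p q * \<omega> b p t * \<omega> d q t) * (\<omega> a r s * \<omega> b r u * \<omega> d s u))"
    unfolding W sum_product3 by (intro sum.cong refl) (simp only: mult_ac)
  also have "\<dots> = (\<Sum>a\<in>UNIV. \<Sum>b\<in>UNIV. \<Sum>d\<in>UNIV.
      \<Sum>p\<in>UNIV. \<Sum>q\<in>UNIV. \<Sum>r\<in>UNIV. \<Sum>s\<in>UNIV. \<Sum>t\<in>UNIV. \<Sum>u\<in>UNIV.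
      (c a * c b * c d) * (\<omega> a p q * \<omega> b p t * \<omega> d q t) * (\<omega> a r s * \<omega> b r u * \<omega> d s u))"
    by (rule sum_swap_6_3)
  finally show ?thesis
    by (simp only: power2_eq_square flip: sum_distrib_left sum_distrib_right)
      (simp only: mult.assoc)
qed

text \<open>Each of the pairs pq, rs, tu occurs in exactly two of the three tensors, so each
  contributes one entry of the Gram matrix.\<close>

lemma form_square_cubic2:
  "(\<Sum>p\<in>UNIV. \<Sum>q\<in>UNIV. \<Sum>r\<in>UNIV. \<Sum>s\<in>UNIV. \<Sum>t\<in>UNIV. \<Sum>u\<in>UNIV.
      W p q r s * W p q t u * W r s t u) =
   (\<Sum>a\<in>UNIV. \<Sum>b\<in>UNIV. \<Sum>d\<in>UNIV. c a * c b * c d *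
      (\<Sum>p\<in>UNIV. \<Sum>q\<in>UNIV. \<omega> a p q * \<omega> b p q) *
      (\<Sum>p\<in>UNIV. \<Sum>q\<in>UNIV. \<omega> a p q * \<omega> d p q) *
      (\<Sum>p\<in>UNIV. \<Sum>q\<in>UNIV. \<omega> b p q * \<omega> d p q))"
proof -
  have "(\<Sum>p\<in>UNIV. \<Sum>q\<in>UNIV. \<Sum>r\<in>UNIV. \<Sum>s\<in>UNIV. \<Sum>t\<in>UNIV. \<Sum>u\<in>UNIV.
      W p q r s * W p q t u * W r s t u) =
    (\<Sum>p\<in>UNIV. \<Sum>q\<in>UNIV. \<Sum>r\<in>UNIV. \<Sum>s\<in>UNIV. \<Sum>t\<in>UNIV. \<Sum>u\<in>UNIV.
      \<Sum>a\<in>UNIV. \<Sum>b\<in>UNIV. \<Sum>d\<in>UNIV.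
      (c a * c b * c d) * (\<omega> a p q * \<omega> b p q) * (\<omega> a r s * \<omega> d r s) * (\<omega> b t u * \<omega> d t u))"
    unfolding W sum_product3 by (intro sum.cong refl) (simp only: mult_ac)
  also have "\<dots> = (\<Sum>a\<in>UNIV. \<Sum>b\<in>UNIV. \<Sum>d\<in>UNIV.
      \<Sum>p\<in>UNIV. \<Sum>q\<in>UNIV. \<Sum>r\<in>UNIV. \<Sum>s\<in>UNIV. \<Sum>t\<in>UNIV. \<Sum>u\<in>UNIV.
      (c a * c b * c d) * (\<omega> a p q * \<omega> b p q) * (\<omega> a r s * \<omega> d r s) * (\<omega> b t u * \<omega> d t u))"
    by (rule sum_swap_6_3)
  finally show ?thesis
    by (simp only: flip: sum_distrib_left sum_distrib_right)
qed

end

section \<open>The extremal tensor\<close>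

lemma comp4_extremal:
  "comp4 extremal p q r s = (\<Sum>a\<in>UNIV. weight a *
     self_dual a (axis p 1) (axis q 1) * self_dual a (axis r 1) (axis s 1))"
  by (simp add: comp4_def extremal_def)

lemma tensor_norm_extremal: "tensor_norm extremal = sqrt 96"
  by (simp add: tensor_norm_def form_square_norm[OF comp4_extremal] self_dual_gram sum_3 weight_def)

text \<open>The first sum has six orderings of distinct forms, each giving 2 * 16, hence 192; the
  second is 64 * (8 - 1 - 1) = 384. So Q = 2 * 192 + 384 / 2.\<close>

lemma Q_extremal: "Q extremal = 576"
  by (simp add: Q_def form_square_cubic1[OF comp4_extremal] form_square_cubic2[OF comp4_extremal]
      self_dual_gram self_dual_triple sum_3 weight_def)

text \<open>Both the Bianchi identity and trace-freeness come from the weights summing to 0: the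
  cyclic sum of \<omega>_a \<otimes> \<omega>_a and its trace (the identity on R^4) do not depend on
  a.\<close>

lemma weyl_tensor_extremal: "weyl_tensor extremal"
  unfolding weyl_tensor_def
proof (intro conjI)
  show "multilinear4 extremal"
    by (simp add: multilinear4_def linear_iff extremal_def sum_3 weight_def self_dual_def wedge_def
        algebra_simps)
  show "has_curvature_symmetries extremal"
    unfolding has_curvature_symmetries_def comp4_def
    by (simp add: extremal_def sum_3 weight_def self_dual_def wedge_def algebra_simps)
  show "trace_free extremal"
    unfolding trace_free_def
  proof (intro allI)
    fix i j
    have "(\<Sum>k\<in>UNIV. comp4 extremal i k j k) = (\<Sum>a\<in>UNIV. weight a *
        (\<Sum>k\<in>UNIV. self_dual a (axis i 1) (axis k 1) * self_dual a (axis j 1) (axis k 1)))"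
      unfolding comp4_extremal by (subst sum.swap) (simp add: sum_distrib_left mult.assoc)
    also have "\<dots> = 0"
      unfolding sum_self_dual_right_mult sum_3 weight_def
      by (simp add: self_dual_def wedge_def) (simp add: axis_def)
    finally show "(\<Sum>k\<in>UNIV. comp4 extremal i k j k) = 0" .
  qed
qed

section \<open>A crude upper bound for Q\<close>

lemma abs_comp4_le_tensor_norm: "\<bar>comp4 W i j k l\<bar> \<le> tensor_norm W"
proof -
  have le: "f x \<le> (\<Sum>x\<in>UNIV. f x)" if "\<And>x. f x \<ge> 0" for f :: "6 \<Rightarrow> real" and x
    using that by (intro member_le_sum) auto
  have "comp4 W i j k l * comp4 W i j k l \<le>
      (\<Sum>i\<in>UNIV. \<Sum>j\<in>UNIV. \<Sum>k\<in>UNIV. \<Sum>l\<in>UNIV. comp4 W i j k l * comp4 W i j k l)"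
    by (rule order_trans[OF le order_trans[OF le order_trans[OF le le]]]) (auto intro!: sum_nonneg)
  then show ?thesis
    unfolding tensor_norm_def by (intro real_le_rsqrt) (simp add: power2_eq_square)
qed

text \<open>This makes the set of admissible constants nonempty, without which its infimum carries
  no information. Each sum has 6^6 terms, each at most the cube of the norm.\<close>

lemma Q_bounded: "Q W \<le> (2 * 6 ^ 6 + 6 ^ 6 / 2) * tensor_norm W ^ 3"
proof -
  let ?w = "comp4 W" and ?N = "tensor_norm W"
  have prod: "?w i j k l * ?w i' j' k' l' * ?w i'' j'' k'' l'' \<le> ?N ^ 3"
    for i j k l i' j' k' l' i'' j'' k'' l''
  proof -
    have "\<bar>?w i j k l\<bar> * \<bar>?w i' j' k' l'\<bar> * \<bar>?w i'' j'' k'' l''\<bar> \<le> ?N * ?N * ?N"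
      by (intro mult_mono abs_comp4_le_tensor_norm mult_nonneg_nonneg)
        (auto intro: order_trans[OF abs_ge_zero abs_comp4_le_tensor_norm])
    then show ?thesis
      by (simp add: power3_eq_cube flip: abs_mult)
  qed
  have sum6: "(\<Sum>x\<in>UNIV. f x) \<le> 6 * b" if "\<And>x. f x \<le> b" for f :: "6 \<Rightarrow> real" and b
    using sum_bounded_above[of UNIV f b] that by simp
  have six: "(\<Sum>p\<in>UNIV. \<Sum>q\<in>UNIV. \<Sum>r\<in>UNIV. \<Sum>s\<in>UNIV. \<Sum>t\<in>UNIV. \<Sum>u\<in>UNIV. f p q r s t u) \<le>
      6 * (6 * (6 * (6 * (6 * (6 * b)))))" if "\<And>p q r s t u. f p q r s t u \<le> b"
    for f :: "6 \<Rightarrow> 6 \<Rightarrow> 6 \<Rightarrow> 6 \<Rightarrow> 6 \<Rightarrow> 6 \<Rightarrow> real" and b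
    by (intro sum6 that)
  show ?thesis
    unfolding Q_def
    using six[of "\<lambda>p q r s t u. ?w p q r s * ?w p t r u * ?w q t s u", OF prod]
      six[of "\<lambda>p q r s t u. ?w p q r s * ?w p q t u * ?w r s t u", OF prod]
    by (simp add: algebra_simps)
qed

theorem mainTheorem3:
  shows "C_min \<ge> sqrt (3 / 10)"
  unfolding C_min_def
proof (rule cInf_greatest)
  show "{C. \<forall>W. weyl_tensor W \<longrightarrow> Q W \<le> C * tensor_norm W ^ 3} \<noteq> {}"
    using Q_bounded by blast
next
  fix C :: real
  assume "C \<in> {C. \<forall>W. weyl_tensor W \<longrightarrow> Q W \<le> C * tensor_norm W ^ 3}"
  then have "576 \<le> C * sqrt 96 ^ 3"
    using weyl_tensor_extremal Q_extremal tensor_norm_extremal by fastforce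
  moreover have "sqrt (3 / 8) * sqrt 96 ^ 3 = 576"
  proof -
    \<comment> \<open>Pairing one factor sqrt 96 with sqrt (3/8) gives sqrt 36 = 6, and 6 * 96 =
      576.\<close>
    have "sqrt (3 / 8) * sqrt 96 ^ 3 = sqrt (3 / 8 * 96) * (sqrt 96)\<^sup>2"
      by (simp only: real_sqrt_mult power3_eq_cube power2_eq_square mult.assoc)
    then show ?thesis by simp
  qed
  ultimately have "sqrt (3 / 8) * sqrt 96 ^ 3 \<le> C * sqrt 96 ^ 3"
    by simp
  then have "sqrt (3 / 8) \<le> C"
    by simp
  moreover have "sqrt (3 / 10) \<le> sqrt (3 / 8)"
    by simp
  ultimately show "sqrt (3 / 10) \<le> C"
    by linarith
qed

end
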